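(* Let $G$ be a finite abstract simplicial complex with $n$ sets, and let $K$ be its counting matrix, i.e. the $n\times n$ integer matrix with entries $K(x,y)=|W^-(x)\cap W^-(y)|$ for $x,y\in G$. Then $K\in SL(n,\mathbb{Z})$, i.e. $\det K=1$.
   Context: A finite abstract simplicial complex $G$ is a finite set of non-empty finite sets that is closed under taking non-empty subsets (the empty set is not an element of $G$). Write $n=|G|$ for the number of sets in $G$. For $x\in G$, the core of $x$ is $W^-(x)=\{u\in G : u\subseteq x\}$, i.e. the set of all non-empty subsets of $x$. The counting matrix $K$ of $G$ has its rows and columns indexed by the elements of $G$ (in some fixed order, the same for rows and columns), with $K(x,y)=|W^-(x)\cap W^-(y)|=2^{|x\cap y|}-1$. *)

theory Defs
  imports "Jordan_Normal_Form.Determinant"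
begin

definition finite_abstract_simplicial_complex :: "'a set set \<Rightarrow> bool" where
  "finite_abstract_simplicial_complex G \<longleftrightarrow>
     finite G \<and>
     (\<forall>x\<in>G. finite x \<and> x \<noteq> {}) \<and>
     (\<forall>x\<in>G. \<forall>y. y \<subseteq> x \<and> y \<noteq> {} \<longrightarrow> y \<in> G)"

definition core :: "'a set set \<Rightarrow> 'a set \<Rightarrow> 'a set set" where
  "core G x = {u \<in> G. u \<subseteq> x}"

text \<open>The function \<open>e\<close> is meant to be an enumeration of \<open>G\<close>, that is, a bijection from
  \<open>{..<card G}\<close> to \<open>G\<close>; it fixes the common order of the rows and columns.\<close>

definition counting_matrix :: "'a set set \<Rightarrow> (nat \<Rightarrow> 'a set) \<Rightarrow> int mat" where
  "counting_matrix G e =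
     mat (card G) (card G) (\<lambda>(i, j). int (card (core G (e i) \<inter> core G (e j))))"

definition SL_int :: "nat \<Rightarrow> int mat set" where
  "SL_int n = {A \<in> carrier_mat n n. det A = 1}"

end

theory Submission
  imports Defs
begin

text \<open>
  The counting matrix is a Gram matrix of the inclusion relation. Let \<open>Z\<close> be the square
  0-1 matrix with \<open>Z(x,u) = 1\<close> iff \<open>u \<subseteq> x\<close>. The row of \<open>x\<close> is the indicator
  function of the core of \<open>x\<close>, so the scalar product of the rows of \<open>x\<close> and \<open>y\<close> counts the common
  elements of the two cores, and \<open>K = Z Z\<^sup>T\<close> (\<open>counting_matrix_factorization\<close>).
  Hence \<open>det K = (det Z)\<^sup>2\<close>.

  For a linear order of the sets that refines the order by cardinality, \<open>Z\<close> is triangular with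
  unit diagonal. The order of rows and columns being arbitrary here, the determinant is instead read off
  the Leibniz formula: a permutation contributes only if it sends each set to one of its subsets,
  and on finite sets only the identity does so (\<open>shrinking_permutation_is_id\<close>). So \<open>det Z = 1\<close>.
\<close>

definition inclusion_matrix :: "nat \<Rightarrow> (nat \<Rightarrow> 'a set) \<Rightarrow> int mat" where
  "inclusion_matrix n e = mat n n (\<lambda>(i, k). of_bool (e k \<subseteq> e i))"

text \<open>A permutation preserves the total cardinality of the family, so it cannot replace any
  member by a proper subset unless some other member grows.\<close>

lemma shrinking_permutation_is_id:
  assumes p: "p permutes I" and "finite I"
    and inj: "inj_on e I"
    and fin: "\<And>i. i \<in> I \<Longrightarrow> finite (e i)"
    and sub: "\<And>i. i \<in> I \<Longrightarrow> e (p i) \<subseteq> e i"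
  shows "p = id"
proof
  have total: "(\<Sum>i\<in>I. card (e (p i))) = (\<Sum>i\<in>I. card (e i))"
    using sum.permute[OF p, of "\<lambda>i. card (e i)"] by (simp add: o_def)
  fix i
  show "p i = id i"
  proof (cases "i \<in> I")
    case True
    have "card (e (p i)) = card (e i)"
      using sum_mono_inv[OF total _ True \<open>finite I\<close>] fin sub by (simp add: card_mono)
    then have "e (p i) = e i"
      using fin sub True by (simp add: card_subset_eq)
    then show ?thesis
      using inj True permutes_in_image[OF p] by (simp add: inj_on_eq_iff)
  next
    case False
    then show ?thesis
      using p by (simp add: permutes_not_in)
  qed
qed

lemma det_inclusion_matrix:
  assumes inj: "inj_on e {..<n}"
    and fin: "\<And>i. i < n \<Longrightarrow> finite (e i)"
  shows "det (inclusion_matrix n e) = 1"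
proof -
  let ?Z = "inclusion_matrix n e"
  let ?term = "\<lambda>p. signof p * (\<Prod>i = 0..<n. ?Z $$ (i, p i))"
  have vanish: "?term p = 0" if p: "p permutes {0..<n}" and "p \<noteq> id" for p
  proof -
    have "\<exists>i\<in>{0..<n}. \<not> e (p i) \<subseteq> e i"
      using shrinking_permutation_is_id[OF p, of e] that inj fin
      by (auto simp: atLeast0LessThan)
    then obtain i where i: "i < n" "\<not> e (p i) \<subseteq> e i"
      by (meson atLeastLessThan_iff)
    moreover have "p i < n"
      using permutes_in_image[OF p, of i] i by simp
    ultimately have "?Z $$ (i, p i) = 0"
      by (simp add: inclusion_matrix_def)
    then have "(\<Prod>i = 0..<n. ?Z $$ (i, p i)) = 0"
      using i by (intro prod_zero) auto
    then show ?thesis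
      by simp
  qed
  have "det ?Z = (\<Sum>p\<in>{p. p permutes {0..<n}}. ?term p)"
    by (rule det_def') (simp add: inclusion_matrix_def)
  also have "\<dots> = (\<Sum>p\<in>{id}. ?term p)"
    using vanish by (intro sum.mono_neutral_right)
      (auto simp: finite_permutations permutes_id)
  also have "\<dots> = 1"
    by (simp add: inclusion_matrix_def)
  finally show ?thesis .
qed

lemma counting_matrix_factorization:
  assumes bij: "bij_betw e {..<card G} G"
  shows "counting_matrix G e =
    inclusion_matrix (card G) e * transpose_mat (inclusion_matrix (card G) e)"
    (is "_ = ?Z * _")
proof (rule eq_matI)
  fix i j
  assume "i < dim_row (?Z * transpose_mat ?Z)" and "j < dim_col (?Z * transpose_mat ?Z)"
  then have ij: "i < card G" "j < card G"
    by (auto simp: inclusion_matrix_def)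
  let ?S = "{k \<in> {..<card G}. e k \<subseteq> e i \<and> e k \<subseteq> e j}"
  have "core G (e i) \<inter> core G (e j) = {u \<in> e ` {..<card G}. u \<subseteq> e i \<and> u \<subseteq> e j}"
    using bij_betw_imp_surj_on[OF bij] by (auto simp: core_def)
  also have "\<dots> = e ` ?S"
    by blast
  finally have "core G (e i) \<inter> core G (e j) = e ` ?S" .
  moreover have "inj_on e ?S"
    using bij by (auto simp: bij_betw_def inj_on_def)
  ultimately have "int (card (core G (e i) \<inter> core G (e j))) = int (card ?S)"
    by (simp add: card_image)
  also have "\<dots> = (\<Sum>k\<in>{..<card G}. of_bool (e k \<subseteq> e i \<and> e k \<subseteq> e j))"
    by (simp add: sum_of_bool_eq Int_def)
  also have "\<dots> = (?Z * transpose_mat ?Z) $$ (i, j)"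
    using ij by (simp add: inclusion_matrix_def scalar_prod_def atLeast0LessThan
        of_bool_conj del: sum_of_bool_eq)
  finally show "counting_matrix G e $$ (i, j) = (?Z * transpose_mat ?Z) $$ (i, j)"
    using ij by (simp add: counting_matrix_def)
qed (simp_all add: counting_matrix_def inclusion_matrix_def)

theorem theorem1:
  fixes G :: "'a set set" and e :: "nat \<Rightarrow> 'a set" and n :: nat
  assumes "finite_abstract_simplicial_complex G"
    and "n = card G"
    and "bij_betw e {..<n} G"
  shows "counting_matrix G e \<in> SL_int n \<and> det (counting_matrix G e) = 1"
proof -
  let ?Z = "inclusion_matrix n e"
  have "finite (e i)" if "i < n" for i
    using assms that bij_betwE[OF assms(3)]
    by (simp add: finite_abstract_simplicial_complex_def)
  then have det_Z: "det ?Z = 1"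
    using assms(3) by (intro det_inclusion_matrix) (auto simp: bij_betw_def)
  have Z: "?Z \<in> carrier_mat n n"
    by (simp add: inclusion_matrix_def)
  have "det (counting_matrix G e) = det ?Z * det (transpose_mat ?Z)"
    using counting_matrix_factorization[of e G] assms(2,3) Z by (simp add: det_mult)
  also have "\<dots> = 1"
    using det_Z by (simp add: det_transpose[OF Z])
  finally show ?thesis
    using assms(2) by (simp add: SL_int_def counting_matrix_def)
qed

end
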